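(* Let $p_1,p_2,q_1,q_2$ be pairwise distinct primes, and let $M\le N\le U$ and $e_\alpha$ ($\alpha<\omega$) be as in the context. If $f:N\to N$ is a group homomorphism with $f(e_\alpha)=e_\alpha$ for all $\alpha<\omega$, then $f=\operatorname{id}_N$.
   Context: $U:=\prod_{\alpha<\omega}\mathbb{Q}e_\alpha$ (so $e_\alpha$ is the element with $1$ in coordinate $\alpha$ and $0$ elsewhere), $\mathbb{Z}[1/p,1/q]$ denotes the subring of $\mathbb{Q}$ generated by $1/p,1/q$, and $M:=\bigoplus_{\alpha<\omega}\mathbb{Z}[1/p_1,1/p_2]e_\alpha\le U$. For each $\alpha<\omega$ fix integers $c_\alpha,d_\alpha$ with $c_\alpha q_1^\alpha+d_\alpha q_2^\alpha=1$, and set $y_\alpha:=\sum_{k\ge\alpha}c_kq_1^{k-\alpha}e_k$ and $z_\alpha:=\sum_{k\ge\alpha}d_kq_2^{k-\alpha}e_k$. Let $N$ be the subgroup of $U$ generated by $M$ together with $\mathbb{Z}[1/p_2]y_\alpha$ and $\mathbb{Z}[1/p_2]z_\alpha$ for all $\alpha<\omega$. *)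

theory Defs
  imports "HOL-Algebra.Product_Groups" "HOL-Algebra.Generated_Rings" "HOL-Computational_Algebra.Primes"
begin

definition rat_ring :: "rat ring"
  where "rat_ring = \<lparr>carrier = UNIV, monoid.mult = (*), one = 1, ring.zero = 0, add = (+)\<rparr>"

text \<open>\<open>Z_inv P\<close> is the subring of the rationals generated by the \<open>1/p\<close> with \<open>p \<in> P\<close>.\<close>

definition Z_inv :: "nat set \<Rightarrow> rat set"
  where "Z_inv P = generate_ring rat_ring ((\<lambda>p. 1 / of_nat p) ` P)"

text \<open>An element of the product is the function of its coordinates; the group operation,
  written multiplicatively in HOL-Algebra, is coordinatewise addition.\<close>

definition U_group :: "(nat \<Rightarrow> rat) monoid"
  where "U_group = product_group UNIV (\<lambda>_. add_monoid rat_ring)"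

definition e_vec :: "nat \<Rightarrow> nat \<Rightarrow> rat"
  where "e_vec \<alpha> = (\<lambda>k. if k = \<alpha> then 1 else 0)"

definition M_group :: "nat \<Rightarrow> nat \<Rightarrow> (nat \<Rightarrow> rat) monoid"
  where "M_group p1 p2 =
    sum_group UNIV (\<lambda>_. (add_monoid rat_ring)\<lparr>carrier := Z_inv {p1, p2}\<rparr>)"

text \<open>\<open>tail_vec c q \<alpha>\<close> is the formal sum of \<open>c k * q ^ (k - \<alpha>) * e_vec k\<close> over
  \<open>k \<ge> \<alpha>\<close>; \<open>tail_vec c q1 \<alpha>\<close> is \<open>y\<^sub>\<alpha>\<close> and \<open>tail_vec d q2 \<alpha>\<close> is \<open>z\<^sub>\<alpha>\<close>.\<close>

definition tail_vec :: "(nat \<Rightarrow> int) \<Rightarrow> nat \<Rightarrow> nat \<Rightarrow> nat \<Rightarrow> rat"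
  where "tail_vec c q \<alpha> = (\<lambda>k. if \<alpha> \<le> k then of_int (c k) * of_nat q ^ (k - \<alpha>) else 0)"

definition scalar_multiples :: "rat set \<Rightarrow> (nat \<Rightarrow> rat) \<Rightarrow> (nat \<Rightarrow> rat) set"
  where "scalar_multiples R v = {(\<lambda>k. r * v k) | r. r \<in> R}"

definition N_group ::
    "nat \<Rightarrow> nat \<Rightarrow> nat \<Rightarrow> nat \<Rightarrow> (nat \<Rightarrow> int) \<Rightarrow> (nat \<Rightarrow> int) \<Rightarrow> (nat \<Rightarrow> rat) monoid"
  where "N_group p1 p2 q1 q2 c d =
    subgroup_generated U_group
      (carrier (M_group p1 p2)
        \<union> (\<Union>\<alpha>. scalar_multiples (Z_inv {p2}) (tail_vec c q1 \<alpha>))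
        \<union> (\<Union>\<alpha>. scalar_multiples (Z_inv {p2}) (tail_vec d q2 \<alpha>)))"

lemma field_rat_ring: "field rat_ring"
proof -
  have minus: "\<exists>y. x + y = 0" for x :: rat
    by (rule exI[of _ "- x"]) simp
  have "cring rat_ring"
    by (rule cringI)
      (auto simp: rat_ring_def algebra_simps minus intro!: abelian_groupI comm_monoidI)
  then show ?thesis
  proof (rule cring.cring_fieldI2)
    show "\<zero>\<^bsub>rat_ring\<^esub> \<noteq> \<one>\<^bsub>rat_ring\<^esub>" by (simp add: rat_ring_def)
    show "\<exists>b\<in>carrier rat_ring. a \<otimes>\<^bsub>rat_ring\<^esub> b = \<one>\<^bsub>rat_ring\<^esub>"
      if "a \<in> carrier rat_ring" "a \<noteq> \<zero>\<^bsub>rat_ring\<^esub>" for a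
      using that by (auto simp: rat_ring_def intro: right_inverse)
  qed
qed

lemma group_U_group: "group U_group"
proof -
  interpret field rat_ring by (rule field_rat_ring)
  show ?thesis
    unfolding U_group_def by (rule product_group) (rule a_group)
qed

lemma U_group_simps [simp]:
  "carrier U_group = UNIV"
  "x \<otimes>\<^bsub>U_group\<^esub> y = (\<lambda>k. x k + y k)"
  "\<one>\<^bsub>U_group\<^esub> = (\<lambda>k. 0)"
  by (auto simp: U_group_def product_group_def rat_ring_def)

lemma subgroup_N_group: "subgroup (carrier (N_group p1 p2 q1 q2 c d)) U_group"
  unfolding N_group_def
  by (rule group.subgroup_subgroup_generated[OF group_U_group])

lemma carrier_M_group:
  "carrier (M_group p1 p2) = {x. finite {k. x k \<noteq> 0} \<and> (\<forall>k. x k \<in> Z_inv {p1, p2})}"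
proof -
  interpret field rat_ring by (rule field_rat_ring)
  have "subring (Z_inv {p1, p2}) rat_ring"
    unfolding Z_inv_def by (rule generate_ring_is_subring) (simp add: rat_ring_def)
  then have "subgroup (Z_inv {p1, p2}) (add_monoid rat_ring)"
    by (rule subring.axioms(1))
  then have "group ((add_monoid rat_ring)\<lparr>carrier := Z_inv {p1, p2}\<rparr>)"
    by (rule group.subgroup_imp_group[OF a_group])
  then show ?thesis
    unfolding M_group_def by (subst carrier_sum_group) (auto simp: rat_ring_def)
qed

lemma carrier_M_subset_N: "carrier (M_group p1 p2) \<subseteq> carrier (N_group p1 p2 q1 q2 c d)"
  by (auto simp: N_group_def carrier_subgroup_generated intro: generate.incl)

end

theory Submission
  imports Defs
begin

text \<open>All coordinates of elements of \<open>N\<close> lie in \<open>\<int>[1/p\<^sub>1, 1/p\<^sub>2]\<close>. Since \<open>N\<close> is torsion-free, the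
  fixed points of \<open>f\<close> form a pure subgroup of \<open>N\<close>, and therefore contain \<open>M\<close>. As
  \<open>y\<^sub>\<alpha> - q\<^sub>1\<^sup>n y\<^bsub>\<alpha>+n\<^esub> \<in> M\<close>, the difference \<open>f y\<^sub>\<alpha> - y\<^sub>\<alpha>\<close> equals
  \<open>q\<^sub>1\<^sup>n (f y\<^bsub>\<alpha>+n\<^esub> - y\<^bsub>\<alpha>+n\<^esub>)\<close> for every \<open>n\<close>. So each of its coordinates is divisible by all powers of \<open>q\<^sub>1\<close>
  in \<open>\<int>[1/p\<^sub>1, 1/p\<^sub>2]\<close>, which forces it to vanish. The same applies to \<open>z\<^sub>\<alpha>\<close> and \<open>q\<^sub>2\<close>.\<close>

section \<open>Subrings of the rationals with restricted denominators\<close>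

lemma rat_ring_simps [simp]:
  "carrier rat_ring = UNIV" "x \<oplus>\<^bsub>rat_ring\<^esub> y = x + y" "x \<otimes>\<^bsub>rat_ring\<^esub> y = x * y"
  "\<zero>\<^bsub>rat_ring\<^esub> = 0" "\<one>\<^bsub>rat_ring\<^esub> = 1"
  by (simp_all add: rat_ring_def)

lemma rat_ring_a_inv [simp]: "\<ominus>\<^bsub>rat_ring\<^esub> x = - x"
proof -
  interpret field rat_ring by (rule field_rat_ring)
  show ?thesis by (rule minus_equality) simp_all
qed

lemma U_group_inv [simp]: "inv\<^bsub>U_group\<^esub> x = (\<lambda>k. - x k)"
  by (rule group.inv_equality[OF group_U_group]) simp_all

lemma subring_Z_inv: "subring (Z_inv P) rat_ring"
proof -
  interpret field rat_ring by (rule field_rat_ring)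
  show ?thesis
    unfolding Z_inv_def by (rule generate_ring_is_subring) simp
qed

lemma Z_inv_closed:
  shows zero_in_Z_inv: "0 \<in> Z_inv P"
    and one_in_Z_inv: "1 \<in> Z_inv P"
    and uminus_in_Z_inv: "x \<in> Z_inv P \<Longrightarrow> - x \<in> Z_inv P"
    and add_in_Z_inv: "x \<in> Z_inv P \<Longrightarrow> y \<in> Z_inv P \<Longrightarrow> x + y \<in> Z_inv P"
    and mult_in_Z_inv: "x \<in> Z_inv P \<Longrightarrow> y \<in> Z_inv P \<Longrightarrow> x * y \<in> Z_inv P"
proof -
  interpret field rat_ring by (rule field_rat_ring)
  note sub = subring_Z_inv[of P]
  show "0 \<in> Z_inv P" "1 \<in> Z_inv P"
    using subringE(2,3)[OF sub] by simp_all
  show "- x \<in> Z_inv P" if "x \<in> Z_inv P"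
    using subringE(5)[OF sub that] by simp
  show "x + y \<in> Z_inv P" if "x \<in> Z_inv P" "y \<in> Z_inv P"
    using subringE(7)[OF sub that] by simp
  show "x * y \<in> Z_inv P" if "x \<in> Z_inv P" "y \<in> Z_inv P"
    using subringE(6)[OF sub that] by simp
qed

lemma of_nat_in_Z_inv: "of_nat n \<in> Z_inv P"
  by (induction n) (auto intro: Z_inv_closed)

lemma of_int_in_Z_inv: "of_int i \<in> Z_inv P"
  by (cases i rule: int_cases2) (auto intro: Z_inv_closed of_nat_in_Z_inv)

lemma power_in_Z_inv: "x \<in> Z_inv P \<Longrightarrow> x ^ n \<in> Z_inv P"
  by (induction n) (auto intro: Z_inv_closed)

lemma Z_inv_mono: "P \<subseteq> Q \<Longrightarrow> Z_inv P \<subseteq> Z_inv Q"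
proof -
  assume "P \<subseteq> Q"
  interpret field rat_ring by (rule field_rat_ring)
  show ?thesis
    unfolding Z_inv_def by (rule mono_generate_ring) (use \<open>P \<subseteq> Q\<close> in auto)
qed

text \<open>Induction over the generation of the ring: a generator \<open>1 / p\<close> has
  denominator \<open>p\<close>, and for sums and products the product of the two denominators works,
  which is again coprime to \<open>q\<close>.\<close>

lemma Z_inv_denominator:
  assumes "x \<in> Z_inv P" and "\<And>p. p \<in> P \<Longrightarrow> coprime q p"
  obtains n where "n > 0" "coprime q n" "of_nat n * x \<in> \<int>"
proof -
  have "\<exists>n>0. coprime q n \<and> of_nat n * x \<in> \<int>"
    using assms(1) unfolding Z_inv_def
  proof (induction rule: generate_ring.induct)
    case one
    show ?case by (intro exI[of _ 1]) simp
  next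
    case (incl h)
    then obtain p where p: "p \<in> P" "h = 1 / of_nat p" by blast
    show ?case
    \<comment> \<open>Here \<open>P\<close> may contain 0, in which case \<open>1 / of_nat p\<close>
      is 0 and the witness is 1 instead of \<open>p\<close>.\<close>
    proof (cases "p = 0")
      case True
      with p show ?thesis by (intro exI[of _ 1]) simp
    next
      case False
      with p assms(2) show ?thesis by (intro exI[of _ p]) simp
    qed
  next
    case (a_inv h)
    then show ?case by auto
  next
    case (eng_add h1 h2)
    then obtain m n where mn: "m > 0" "coprime q m" "of_nat m * h1 \<in> \<int>"
      "n > 0" "coprime q n" "of_nat n * h2 \<in> \<int>" by blast
    have "of_nat (m * n) * (h1 + h2) = of_nat n * (of_nat m * h1) + of_nat m * (of_nat n * h2)"
      by (simp add: algebra_simps)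
    also have "\<dots> \<in> \<int>" by (intro Ints_add Ints_mult[OF Ints_of_nat] mn)
    finally show ?case using mn by (intro exI[of _ "m * n"]) simp
  next
    case (eng_mult h1 h2)
    then obtain m n where mn: "m > 0" "coprime q m" "of_nat m * h1 \<in> \<int>"
      "n > 0" "coprime q n" "of_nat n * h2 \<in> \<int>" by blast
    have "of_nat (m * n) * (h1 * h2) = (of_nat m * h1) * (of_nat n * h2)"
      by (simp add: algebra_simps)
    also have "\<dots> \<in> \<int>" by (intro Ints_mult mn)
    finally show ?case using mn by (intro exI[of _ "m * n"]) simp
  qed
  with that show ?thesis by blast
qed

text \<open>Clearing denominators coprime to \<open>q\<close> turns divisibility inside
  \<open>Z_inv P\<close> into divisibility of one fixed integer \<open>a\<close> by every power of
  \<open>q\<close>, so \<open>a\<close> is 0.\<close>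

lemma Z_inv_power_divisible_eq_0:
  assumes "q > 1" and cop: "\<And>p. p \<in> P \<Longrightarrow> coprime q p"
    and x: "x \<in> Z_inv P"
    and div: "\<And>n. \<exists>w \<in> Z_inv P. x = of_nat q ^ n * w"
  shows "x = 0"
proof -
  obtain m where m: "m > 0" "of_nat m * x \<in> \<int>"
    using Z_inv_denominator[OF x cop] by blast
  then obtain a where a: "of_nat m * x = of_int a" by (auto elim: Ints_cases)
  have "int q ^ n dvd a" for n
  proof -
    obtain w where w: "w \<in> Z_inv P" "x = of_nat q ^ n * w" using div by blast
    obtain l where l: "l > 0" "coprime q l" "of_nat l * w \<in> \<int>"
      using Z_inv_denominator[OF w(1) cop] by blast
    then obtain b where b: "of_nat l * w = of_int b" by (auto elim: Ints_cases)
    \<comment> \<open>The equation \<open>x = of_nat q ^ n * w\<close> is multiplied by both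
      denominators, \<open>m\<close> of \<open>x\<close> and \<open>l\<close> of \<open>w\<close>,
      to become an equation of integers.\<close>
    have "(of_int (int l * a) :: rat) = of_nat l * (of_nat m * x)" using a by simp
    also have "\<dots> = of_nat q ^ n * of_nat m * (of_nat l * w)"
      by (simp add: w(2) algebra_simps)
    also have "\<dots> = of_int (int q ^ n * (int m * b))" using b by simp
    finally have "int l * a = int q ^ n * (int m * b)" by (simp only: of_int_eq_iff)
    then have "int q ^ n dvd int l * a" by simp
    moreover have "coprime (int q ^ n) (int l)" using l(2) by simp
    ultimately show ?thesis by (simp add: coprime_dvd_mult_right_iff)
  qed
  have "a = 0"
  proof (rule ccontr)
    assume "a \<noteq> 0"
    \<comment> \<open>The exponent is chosen as the absolute value of \<open>a\<close> because a
      power of \<open>q > 1\<close> exceeds its exponent.\<close>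
    from dvd_imp_le_int[OF this \<open>int q ^ nat \<bar>a\<bar> dvd a\<close>] have "int q ^ nat \<bar>a\<bar> \<le> \<bar>a\<bar>"
      by (simp add: power_abs)
    moreover have "nat \<bar>a\<bar> < q ^ nat \<bar>a\<bar>"
      using \<open>q > 1\<close> by (intro power_gt_expt) simp
    then have "\<bar>a\<bar> < int (q ^ nat \<bar>a\<bar>)" by linarith
    ultimately show False by simp
  qed
  with a m show ?thesis by simp
qed

section \<open>Additive maps on a subgroup of the product, and their fixed points\<close>

locale additive_on_subgroup =
  fixes N :: "(nat \<Rightarrow> rat) set" and f :: "(nat \<Rightarrow> rat) \<Rightarrow> nat \<Rightarrow> rat"
  assumes subgroup_N: "subgroup N U_group"
    and f_add: "\<And>x y. x \<in> N \<Longrightarrow> y \<in> N \<Longrightarrow> f (\<lambda>k. x k + y k) = (\<lambda>k. f x k + f y k)"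
begin

lemma zero_in_N: "(\<lambda>k. 0) \<in> N"
  using subgroup.one_closed[OF subgroup_N] by simp

lemma add_in_N: "x \<in> N \<Longrightarrow> y \<in> N \<Longrightarrow> (\<lambda>k. x k + y k) \<in> N"
  using subgroup.m_closed[OF subgroup_N] by simp

lemma uminus_in_N: "x \<in> N \<Longrightarrow> (\<lambda>k. - x k) \<in> N"
  using subgroup.m_inv_closed[OF subgroup_N] by simp

lemma f_zero: "f (\<lambda>k. 0) = (\<lambda>k. 0)"
  using f_add[OF zero_in_N zero_in_N] by (simp add: fun_eq_iff)

lemma f_uminus: "x \<in> N \<Longrightarrow> f (\<lambda>k. - x k) = (\<lambda>k. - f x k)"
  using f_add[OF _ uminus_in_N, of x x] f_zero by (simp add: fun_eq_iff eq_neg_iff_add_eq_0 add.commute)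

lemma nat_multiple:
  assumes "x \<in> N"
  shows "(\<lambda>k. of_nat n * x k) \<in> N \<and> f (\<lambda>k. of_nat n * x k) = (\<lambda>k. of_nat n * f x k)"
proof (induction n)
  case 0
  show ?case by (simp add: zero_in_N f_zero)
next
  case (Suc n)
  have "(\<lambda>k. of_nat (Suc n) * x k) = (\<lambda>k. x k + of_nat n * x k)"
    by (simp add: algebra_simps)
  with Suc add_in_N[OF assms, of "\<lambda>k. of_nat n * x k"]
    f_add[OF assms, of "\<lambda>k. of_nat n * x k"] show ?case
    by (simp add: algebra_simps)
qed

definition fixed :: "(nat \<Rightarrow> rat) set"
  where "fixed = {x \<in> N. f x = x}"

lemma subgroup_fixed: "subgroup fixed U_group"
  by (rule group.subgroupI[OF group_U_group])
    (auto simp: fixed_def f_add f_uminus f_zero intro: add_in_N uminus_in_N zero_in_N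
      intro!: exI[of _ "\<lambda>k. 0"])

lemma fixed_add: "x \<in> fixed \<Longrightarrow> y \<in> fixed \<Longrightarrow> (\<lambda>k. x k + y k) \<in> fixed"
  using subgroup.m_closed[OF subgroup_fixed] by simp

lemma fixed_int_multiple:
  assumes "x \<in> fixed"
  shows "(\<lambda>k. of_int i * x k) \<in> fixed"
proof (cases i rule: int_cases2)
  case (nonneg n)
  with assms nat_multiple[of x n] show ?thesis by (simp add: fixed_def)
next
  case (nonpos n)
  have "(\<lambda>k. of_nat n * x k) \<in> fixed"
    using assms nat_multiple[of x n] by (simp add: fixed_def)
  from subgroup.m_inv_closed[OF subgroup_fixed this] nonpos show ?thesis by simp
qed

text \<open>The factor \<open>n\<close> cancels coordinatewise in \<open>n * f x = n * x\<close>,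
  since the coordinates are rational.\<close>

lemma fixed_pure:
  assumes "x \<in> N" and "n > 0" and "(\<lambda>k. of_nat n * x k) \<in> fixed"
  shows "x \<in> fixed"
  using assms nat_multiple[of x n] by (simp add: fixed_def fun_eq_iff)

text \<open>Some positive multiple of \<open>r\<close> is an integer, so integer multiples and
  purity suffice. Membership of the multiple in \<open>N\<close> is a premise because
  \<open>N\<close> need not be closed under multiplication by \<open>Z_inv P\<close>.\<close>

lemma fixed_scalar_multiple:
  assumes "x \<in> fixed" and "r \<in> Z_inv P" and rx: "(\<lambda>k. r * x k) \<in> N"
  shows "(\<lambda>k. r * x k) \<in> fixed"
proof -
  obtain n where n: "n > 0" "of_nat n * r \<in> \<int>"
    \<comment> \<open>Only some positive denominator is wanted; with 1 in place of \<open>q\<close>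
      the coprimality condition holds trivially.\<close>
    using Z_inv_denominator[OF assms(2), of 1] by auto
  then obtain i where "of_nat n * r = of_int i" by (auto elim: Ints_cases)
  then have "(\<lambda>k. of_nat n * (r * x k)) = (\<lambda>k. of_int i * x k)"
    by (simp flip: mult.assoc)
  with fixed_int_multiple[OF assms(1)] fixed_pure[OF rx n(1)] show ?thesis by simp
qed

lemma M_subset_fixed:
  assumes MN: "carrier (M_group p1 p2) \<subseteq> N" and fe: "\<And>\<alpha>. f (e_vec \<alpha>) = e_vec \<alpha>"
  shows "carrier (M_group p1 p2) \<subseteq> fixed"
proof
  have single: "(\<lambda>k. r * e_vec \<alpha> k) \<in> fixed" if r: "r \<in> Z_inv {p1, p2}" for r \<alpha>
  proof -
    have M: "(\<lambda>k. s * e_vec \<alpha> k) \<in> carrier (M_group p1 p2)" if "s \<in> Z_inv {p1, p2}" for s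
      using that by (auto simp: carrier_M_group e_vec_def zero_in_Z_inv)
    from M[OF one_in_Z_inv] MN fe have "e_vec \<alpha> \<in> fixed" by (auto simp: fixed_def)
    with M[OF r] MN r show ?thesis by (blast intro: fixed_scalar_multiple)
  qed
  fix x assume x: "x \<in> carrier (M_group p1 p2)"
  \<comment> \<open>Truncating \<open>x\<close> to a finite set \<open>F\<close> allows adding one
    coordinate at a time; taking the support of \<open>x\<close> for \<open>F\<close> recovers
    \<open>x\<close>.\<close>
  have "(\<lambda>k. if k \<in> F then x k else 0) \<in> fixed" if "finite F" for F
    using that
  proof (induction F rule: finite_induct)
    case empty
    show ?case using subgroup.one_closed[OF subgroup_fixed] by simp
  next
    case (insert a F)
    have "(\<lambda>k. if k \<in> insert a F then x k else 0)
        = (\<lambda>k. x a * e_vec a k + (if k \<in> F then x k else 0))"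
      using insert.hyps by (auto simp: e_vec_def)
    moreover have "x a \<in> Z_inv {p1, p2}" using x by (simp add: carrier_M_group)
    ultimately show ?case using fixed_add[OF single insert.IH] by simp
  qed
  moreover have "(\<lambda>k. if k \<in> {k. x k \<noteq> 0} then x k else 0) = x" by auto
  moreover have "finite {k. x k \<noteq> 0}" using x by (simp add: carrier_M_group)
  ultimately show "x \<in> fixed" by metis
qed

lemma tail_vec_fixed:
  assumes "carrier (M_group p1 p2) \<subseteq> fixed"
    and coords: "\<And>x k. x \<in> N \<Longrightarrow> x k \<in> Z_inv {p1, p2}"
    and fN: "\<And>x. x \<in> N \<Longrightarrow> f x \<in> N"
    and tail: "\<And>\<alpha>. tail_vec c q \<alpha> \<in> N"
    and "q > 1" "coprime q p1" "coprime q p2"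
  shows "tail_vec c q \<alpha> \<in> fixed"
proof -
  have diff: "f (tail_vec c q \<beta>) k - tail_vec c q \<beta> k \<in> Z_inv {p1, p2}" for \<beta> k
    using add_in_Z_inv[OF coords[OF fN[OF tail]] uminus_in_Z_inv[OF coords[OF tail]]] by simp
  have "f (tail_vec c q \<alpha>) k - tail_vec c q \<alpha> k
      = of_nat q ^ n * (f (tail_vec c q (\<alpha> + n)) k - tail_vec c q (\<alpha> + n) k)" for k n
  proof -
    \<comment> \<open>The tail vector is cut at \<open>\<alpha> + n\<close>: the head
      \<open>h\<close> has finite support, hence is fixed, and the rest \<open>t\<close> is
      \<open>q ^ n\<close> times a later tail vector. Subtracting the vector from its image cancels
      \<open>h\<close>.\<close>
    define h where "h = (\<lambda>k. if k < \<alpha> + n then tail_vec c q \<alpha> k else 0)"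
    define t where "t = (\<lambda>k. of_nat (q ^ n) * tail_vec c q (\<alpha> + n) k)"
    have "{k. h k \<noteq> 0} \<subseteq> {..<\<alpha> + n}" by (auto simp: h_def)
    then have "finite {k. h k \<noteq> 0}" by (rule finite_subset) simp
    then have "h \<in> carrier (M_group p1 p2)"
      using coords[OF tail] by (auto simp: carrier_M_group h_def zero_in_Z_inv)
    then have h: "h \<in> N" "f h = h" using assms(1) by (auto simp: fixed_def)
    have t: "t \<in> N" "f t = (\<lambda>k. of_nat (q ^ n) * f (tail_vec c q (\<alpha> + n)) k)"
      using nat_multiple[OF tail, of "q ^ n" "\<alpha> + n"] by (simp_all add: t_def)
    have split: "tail_vec c q \<alpha> = (\<lambda>k. h k + t k)"
    proof
      fix k
      show "tail_vec c q \<alpha> k = h k + t k"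
      proof (cases "k < \<alpha> + n")
        case False
        then have "k - \<alpha> = n + (k - (\<alpha> + n))" by simp
        then have "(of_nat q :: rat) ^ (k - \<alpha>) = of_nat q ^ n * of_nat q ^ (k - (\<alpha> + n))"
          by (metis power_add)
        with False show ?thesis by (simp add: h_def t_def tail_vec_def)
      qed (simp add: h_def t_def tail_vec_def)
    qed
    show ?thesis
      unfolding split using f_add[OF h(1) t(1)] h(2) t(2)
      by (simp add: t_def algebra_simps)
  qed
  \<comment> \<open>The witness is the \<open>k\<close>-th coordinate of the corresponding
    difference for \<open>\<alpha> + n\<close>.\<close>
  with diff have "\<exists>w \<in> Z_inv {p1, p2}. f (tail_vec c q \<alpha>) k - tail_vec c q \<alpha> k = of_nat q ^ n * w"
    for k n by blast
  then have "f (tail_vec c q \<alpha>) k - tail_vec c q \<alpha> k = 0" for k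
    using assms(5-7) diff by (intro Z_inv_power_divisible_eq_0[of q "{p1, p2}"]) auto
  with tail show ?thesis by (auto simp: fixed_def)
qed

end

section \<open>Generators of \<open>N_group\<close> and the coordinates of its elements\<close>

lemma subgroup_coordinates_in_Z_inv: "subgroup {x. \<forall>k. x k \<in> Z_inv P} U_group"
  by (rule group.subgroupI[OF group_U_group])
    (auto intro: Z_inv_closed intro!: exI[of _ "\<lambda>k. 0"])

lemma tail_vec_in_Z_inv: "tail_vec c q \<alpha> k \<in> Z_inv P"
  by (auto simp: tail_vec_def intro!: Z_inv_closed of_int_in_Z_inv power_in_Z_inv of_nat_in_Z_inv)

text \<open>Minimality of the generated subgroup. It serves twice: with the coordinate condition as
  \<open>S\<close>, and finally with \<open>fixed\<close> as \<open>S\<close>.\<close>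

lemma carrier_N_subset:
  assumes "subgroup S U_group" and "carrier (M_group p1 p2) \<subseteq> S"
    and "\<And>\<alpha>. scalar_multiples (Z_inv {p2}) (tail_vec c q1 \<alpha>) \<subseteq> S"
    and "\<And>\<alpha>. scalar_multiples (Z_inv {p2}) (tail_vec d q2 \<alpha>) \<subseteq> S"
  shows "carrier (N_group p1 p2 q1 q2 c d) \<subseteq> S"
  unfolding N_group_def carrier_subgroup_generated
  by (rule group.generate_subgroup_incl[OF group_U_group _ assms(1)]) (use assms(2-) in blast)

lemma scalar_multiples_tail_subset_N:
  "scalar_multiples (Z_inv {p2}) (tail_vec c q1 \<alpha>) \<subseteq> carrier (N_group p1 p2 q1 q2 c d)"
  "scalar_multiples (Z_inv {p2}) (tail_vec d q2 \<alpha>) \<subseteq> carrier (N_group p1 p2 q1 q2 c d)"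
  by (auto simp: N_group_def carrier_subgroup_generated intro: generate.incl)

lemma self_in_scalar_multiples: "v \<in> scalar_multiples (Z_inv P) v"
  unfolding scalar_multiples_def using one_in_Z_inv by force

text \<open>It suffices to check generators: those from \<open>M_group\<close> satisfy this by
  definition, and tail vectors have integer coordinates, which are multiplied by scalars from the
  smaller ring \<open>Z_inv {p2}\<close>.\<close>

lemma carrier_N_coordinates:
  assumes "x \<in> carrier (N_group p1 p2 q1 q2 c d)"
  shows "x k \<in> Z_inv {p1, p2}"
proof -
  have "Z_inv {p2} \<subseteq> Z_inv {p1, p2}" by (rule Z_inv_mono) simp
  then have "carrier (N_group p1 p2 q1 q2 c d) \<subseteq> {x. \<forall>k. x k \<in> Z_inv {p1, p2}}"
    by (intro carrier_N_subset subgroup_coordinates_in_Z_inv)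
      (auto simp: carrier_M_group scalar_multiples_def intro!: mult_in_Z_inv tail_vec_in_Z_inv)
  with assms show ?thesis by blast
qed

theorem theorem3p12:
  fixes p1 p2 q1 q2 :: nat
    and c d :: "nat \<Rightarrow> int"
    and f :: "(nat \<Rightarrow> rat) \<Rightarrow> (nat \<Rightarrow> rat)"
  assumes "Factorial_Ring.prime p1" and "Factorial_Ring.prime p2" and "Factorial_Ring.prime q1" and "Factorial_Ring.prime q2"
    and "distinct [p1, p2, q1, q2]"
    and "\<And>\<alpha>. c \<alpha> * int q1 ^ \<alpha> + d \<alpha> * int q2 ^ \<alpha> = 1"
    and "f \<in> hom (N_group p1 p2 q1 q2 c d) (N_group p1 p2 q1 q2 c d)"
    and "\<And>\<alpha>. f (e_vec \<alpha>) = e_vec \<alpha>"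
  shows "\<forall>x \<in> carrier (N_group p1 p2 q1 q2 c d). f x = x"
proof -
  let ?N = "carrier (N_group p1 p2 q1 q2 c d)"
  have mult_N: "x \<otimes>\<^bsub>N_group p1 p2 q1 q2 c d\<^esub> y = (\<lambda>k. x k + y k)" for x y
    by (simp add: N_group_def)
  interpret additive_on_subgroup ?N f
  proof (rule additive_on_subgroup.intro)
    show "f (\<lambda>k. x k + y k) = (\<lambda>k. f x k + f y k)" if "x \<in> ?N" "y \<in> ?N" for x y
      using hom_mult[OF assms(7) that] by (simp add: mult_N)
  qed (rule subgroup_N_group)
  have M: "carrier (M_group p1 p2) \<subseteq> fixed"
    using carrier_M_subset_N assms(8) by (rule M_subset_fixed)
  have fN: "f x \<in> ?N" if "x \<in> ?N" for x
    using hom_in_carrier[OF assms(7) that] .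
  have y: "tail_vec c q1 \<alpha> \<in> fixed" for \<alpha>
  proof (rule tail_vec_fixed[OF M])
    show "tail_vec c q1 \<beta> \<in> ?N" for \<beta>
      using scalar_multiples_tail_subset_N(1) self_in_scalar_multiples by (rule subsetD)
  qed (use assms(1-5) carrier_N_coordinates fN in \<open>auto intro: prime_gt_Suc_0_nat primes_coprime\<close>)
  have z: "tail_vec d q2 \<alpha> \<in> fixed" for \<alpha>
  proof (rule tail_vec_fixed[OF M])
    show "tail_vec d q2 \<beta> \<in> ?N" for \<beta>
      using scalar_multiples_tail_subset_N(2) self_in_scalar_multiples by (rule subsetD)
  qed (use assms(1-5) carrier_N_coordinates fN in \<open>auto intro: prime_gt_Suc_0_nat primes_coprime\<close>)
  \<comment> \<open>Fixing the tail vectors themselves is not enough, as the generators are their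
    multiples by fractions; these lie in \<open>N_group\<close>, so purity applies.\<close>
  have scalar: "scalar_multiples (Z_inv {p2}) v \<subseteq> fixed"
    if "v \<in> fixed" "scalar_multiples (Z_inv {p2}) v \<subseteq> ?N" for v
    using that fixed_scalar_multiple[OF that(1)] by (auto simp: scalar_multiples_def)
  have "?N \<subseteq> fixed"
    by (intro carrier_N_subset subgroup_fixed M scalar y z scalar_multiples_tail_subset_N)
  then show ?thesis by (auto simp: fixed_def)
qed

end
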